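(* Let $n$ be a positive integer and consider the equation $$x^4+y^4+z^4-2x^2y^2-2y^2z^2-2z^2x^2=n .\qquad ( * )$$ If $(x_0,y_0,z_0)$ is a nonnegative integer solution to $( * )$, then one of the following three sets of conditions must occur: either $C_1$: $x_0=\frac{b+c}{2}$, $y_0=\frac{a-b}{2}$, $z_0=\frac{a-c}{2}$, where $a,b,c,d$ are positive integers satisfying $a+d=b+c$, $abcd=n$, $a\equiv b\equiv c\equiv d\pmod 2$, and $a\ge b$, $a\ge c$, $a\ge d$; or $C_2$: $x_0=\frac{b-c}{2}$, $y_0=\frac{a-b}{2}$, $z_0=\frac{a+c}{2}$, where $a,b,c,d$ are positive integers satisfying $a+d=b+c$, $abcd=n$, $a\equiv b\equiv c\equiv d\pmod 2$, and $a\ge b\ge c$; or $C_3$: $x_0=\frac{c-b}{2}$, $y_0=\frac{a+b}{2}$, $z_0=\frac{a-c}{2}$, where $a,b,c,d$ are positive integers satisfying $a+d=b+c$, $abcd=n$, $a\equiv b\equiv c\equiv d\pmod 2$, and $a\ge c\ge b$. Conversely, every nonnegative integer solution of $( * )$ can be obtained from one of the three sets of conditions $C_1$, $C_2$, or $C_3$.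
   Formalization: The printed relation a+d=b+c in C_2 and C_3 is a sign slip (n=9, (0,1,2) satisfies none of C_1, C_2, C_3); it is replaced by a-d=b-c in C_2 and a-d=c-b in C_3. The converse is proved as: every triple from C_1, C_2 or C_3 is a nonnegative integer solution. *)

theory Defs
  imports Complex_Main "HOL-Number_Theory.Cong"
begin

definition quartic_eq :: "int \<Rightarrow> int \<Rightarrow> int \<Rightarrow> int \<Rightarrow> bool" where
  "quartic_eq n x y z \<longleftrightarrow>
     x^4 + y^4 + z^4 - 2 * x^2 * y^2 - 2 * y^2 * z^2 - 2 * z^2 * x^2 = n"

definition nonneg_solution :: "int \<Rightarrow> int \<Rightarrow> int \<Rightarrow> int \<Rightarrow> bool" where
  "nonneg_solution n x y z \<longleftrightarrow> x \<ge> 0 \<and> y \<ge> 0 \<and> z \<ge> 0 \<and> quartic_eq n x y z"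

definition parameters :: "int \<Rightarrow> int \<Rightarrow> int \<Rightarrow> int \<Rightarrow> int \<Rightarrow> bool" where
  "parameters n a b c d \<longleftrightarrow>
     a > 0 \<and> b > 0 \<and> c > 0 \<and> d > 0 \<and> a * b * c * d = n \<and>
     [a = b] (mod 2) \<and> [b = c] (mod 2) \<and> [c = d] (mod 2)"

text \<open>
  The left-hand side of the equation factors as
  (x + y + z) (x - y + z) (x + y - z) (x - y - z).  In all three cases a is the
  first factor.  In C1 the factors are a, b, c, d; in C2 they are a, b, -c, -d;
  in C3 they are a, -b, c, -d.  Since the first and last factors have the same
  sum as the middle two, the linear relation is a + d = b + c in C1,
  a - d = b - c in C2, and a - d = c - b in C3.

  The source prints a + d = b + c in all three cases.  This is a sign error in
  C2 and C3: for n = 9 the solution (0, 1, 2) would then satisfy none of the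
  three conditions, and a = 5, b = c = 3, d = 1 would give, in C2, the triple
  (0, 1, 4), where the left-hand side is 225 instead of 45.  The linear
  relations of C2 and C3 are corrected below, and nothing else is changed.
\<close>

definition C1 :: "int \<Rightarrow> int \<Rightarrow> int \<Rightarrow> int \<Rightarrow> bool" where
  "C1 n x y z \<longleftrightarrow> (\<exists>a b c d :: int.
     real_of_int x = (real_of_int b + real_of_int c) / 2 \<and>
     real_of_int y = (real_of_int a - real_of_int b) / 2 \<and>
     real_of_int z = (real_of_int a - real_of_int c) / 2 \<and>
     parameters n a b c d \<and> a + d = b + c \<and> a \<ge> b \<and> a \<ge> c \<and> a \<ge> d)"

definition C2 :: "int \<Rightarrow> int \<Rightarrow> int \<Rightarrow> int \<Rightarrow> bool" where
  "C2 n x y z \<longleftrightarrow> (\<exists>a b c d :: int.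
     real_of_int x = (real_of_int b - real_of_int c) / 2 \<and>
     real_of_int y = (real_of_int a - real_of_int b) / 2 \<and>
     real_of_int z = (real_of_int a + real_of_int c) / 2 \<and>
     parameters n a b c d \<and> a - d = b - c \<and> a \<ge> b \<and> b \<ge> c)"

definition C3 :: "int \<Rightarrow> int \<Rightarrow> int \<Rightarrow> int \<Rightarrow> bool" where
  "C3 n x y z \<longleftrightarrow> (\<exists>a b c d :: int.
     real_of_int x = (real_of_int c - real_of_int b) / 2 \<and>
     real_of_int y = (real_of_int a + real_of_int b) / 2 \<and>
     real_of_int z = (real_of_int a - real_of_int c) / 2 \<and>
     parameters n a b c d \<and> a - d = c - b \<and> a \<ge> c \<and> c \<ge> b)"

end

theory Submission
  imports Defs
begin

text \<open>
  The quartic form is the negative of Heron's expression for $16$ times the squared area of a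
  triangle with sides $x, y, z$, so it splits into the four linear forms
  $A = x + y + z$, $B = x - y + z$, $C = x + y - z$, $D = x - y - z$ (lemma
  \<open>quartic_factorization\<close>).  These have equal parity and satisfy $A + D = B + C = 2x$,
  $A - B = C - D = 2y$ and $A - C = B - D = 2z$, so $(x, y, z)$ and the quadruples with
  $A + D = B + C$ and a common parity determine each other.

  If $x, y, z \ge 0$ and the product $n$ is positive, then $A > 0$ and $D \le B, C$, while
  $B + C \ge 0$ forbids that $B$ and $C$ are both negative.  The only sign patterns left for
  $(B, C, D)$ are $(+,+,+)$, $(+,-,-)$ and $(-,+,-)$.  The three sets of conditions are exactly
  these three patterns, with the parameters being the absolute values of the four factors; this
  is the content of \<open>C1_iff\<close>, \<open>C2_iff\<close> and \<open>C3_iff\<close>, from which both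
  directions are read off.
\<close>

lemma quartic_factorization:
  fixes x y z :: int
  shows "x^4 + y^4 + z^4 - 2 * x^2 * y^2 - 2 * y^2 * z^2 - 2 * z^2 * x^2 =
         (x + y + z) * (x - y + z) * (x + y - z) * (x - y - z)"
  by algebra

lemma of_int_eq_half_iff:
  fixes x u v :: int
  shows "real_of_int x = (real_of_int u + real_of_int v) / 2 \<longleftrightarrow> 2 * x = u + v"
    and "real_of_int x = (real_of_int u - real_of_int v) / 2 \<longleftrightarrow> 2 * x = u - v"
proof -
  have "real_of_int x = real_of_int w / 2 \<longleftrightarrow> 2 * x = w" for w
    by linarith
  from this[of "u + v"] this[of "u - v"]
  show "real_of_int x = (real_of_int u + real_of_int v) / 2 \<longleftrightarrow> 2 * x = u + v"
    and "real_of_int x = (real_of_int u - real_of_int v) / 2 \<longleftrightarrow> 2 * x = u - v"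
    by simp_all
qed

text \<open>
  In each of the next three lemmas the halved equations, together with the linear relation, are
  inverted to express the parameters as signed linear factors.  The order conditions then supply
  the nonnegativity of those coordinates that are half a difference of parameters.
\<close>

lemma C1_iff:
  "C1 n x y z \<longleftrightarrow> nonneg_solution n x y z \<and>
     0 < x + y + z \<and> 0 < x - y + z \<and> 0 < x + y - z \<and> 0 < x - y - z"
proof
  assume "C1 n x y z"
  then obtain a b c d where h: "2 * x = b + c" "2 * y = a - b" "2 * z = a - c"
      "parameters n a b c d" "a + d = b + c" "a \<ge> b" "a \<ge> c"
    unfolding C1_def of_int_eq_half_iff by blast
  have "a = x + y + z" "b = x - y + z" "c = x + y - z" "d = x - y - z"
    using h by linarith+
  with h show "nonneg_solution n x y z \<and>
      0 < x + y + z \<and> 0 < x - y + z \<and> 0 < x + y - z \<and> 0 < x - y - z"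
    by (auto simp: nonneg_solution_def quartic_eq_def quartic_factorization parameters_def)
next
  assume "nonneg_solution n x y z \<and>
      0 < x + y + z \<and> 0 < x - y + z \<and> 0 < x + y - z \<and> 0 < x - y - z"
  then show "C1 n x y z"
    unfolding C1_def of_int_eq_half_iff
    by (intro exI[of _ "x + y + z"] exI[of _ "x - y + z"] exI[of _ "x + y - z"]
          exI[of _ "x - y - z"])
       (auto simp: nonneg_solution_def quartic_eq_def quartic_factorization parameters_def
          cong_iff_dvd_diff)
qed

lemma C2_iff:
  "C2 n x y z \<longleftrightarrow> nonneg_solution n x y z \<and>
     0 < x + y + z \<and> 0 < x - y + z \<and> x + y - z < 0 \<and> x - y - z < 0"
proof
  assume "C2 n x y z"
  then obtain a b c d where h: "2 * x = b - c" "2 * y = a - b" "2 * z = a + c"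
      "parameters n a b c d" "a - d = b - c" "a \<ge> b" "b \<ge> c"
    unfolding C2_def of_int_eq_half_iff by blast
  have e: "a = x + y + z" "b = x - y + z" "c = - (x + y - z)" "d = - (x - y - z)"
    using h by linarith+
  have "(x + y + z) * (x - y + z) * (x + y - z) * (x - y - z) = a * b * c * d"
    unfolding e by (simp only: mult_minus_left mult_minus_right minus_minus)
  with h e show "nonneg_solution n x y z \<and>
      0 < x + y + z \<and> 0 < x - y + z \<and> x + y - z < 0 \<and> x - y - z < 0"
    unfolding nonneg_solution_def quartic_eq_def quartic_factorization parameters_def
    by linarith
next
  assume r: "nonneg_solution n x y z \<and>
      0 < x + y + z \<and> 0 < x - y + z \<and> x + y - z < 0 \<and> x - y - z < 0"
  then have "(x + y + z) * (x - y + z) * - (x + y - z) * - (x - y - z) = n"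
    unfolding nonneg_solution_def quartic_eq_def quartic_factorization
    by (simp only: mult_minus_left mult_minus_right minus_minus)
  with r show "C2 n x y z"
    unfolding C2_def of_int_eq_half_iff parameters_def
    by (intro exI[of _ "x + y + z"] exI[of _ "x - y + z"] exI[of _ "- (x + y - z)"]
          exI[of _ "- (x - y - z)"])
       (auto simp: nonneg_solution_def cong_iff_dvd_diff)
qed

lemma C3_iff:
  "C3 n x y z \<longleftrightarrow> nonneg_solution n x y z \<and>
     0 < x + y + z \<and> x - y + z < 0 \<and> 0 < x + y - z \<and> x - y - z < 0"
proof
  assume "C3 n x y z"
  then obtain a b c d where h: "2 * x = c - b" "2 * y = a + b" "2 * z = a - c"
      "parameters n a b c d" "a - d = c - b" "a \<ge> c" "c \<ge> b"
    unfolding C3_def of_int_eq_half_iff by blast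
  have e: "a = x + y + z" "b = - (x - y + z)" "c = x + y - z" "d = - (x - y - z)"
    using h by linarith+
  have "(x + y + z) * (x - y + z) * (x + y - z) * (x - y - z) = a * b * c * d"
    unfolding e by (simp only: mult_minus_left mult_minus_right minus_minus)
  with h e show "nonneg_solution n x y z \<and>
      0 < x + y + z \<and> x - y + z < 0 \<and> 0 < x + y - z \<and> x - y - z < 0"
    unfolding nonneg_solution_def quartic_eq_def quartic_factorization parameters_def
    by linarith
next
  assume r: "nonneg_solution n x y z \<and>
      0 < x + y + z \<and> x - y + z < 0 \<and> 0 < x + y - z \<and> x - y - z < 0"
  then have "(x + y + z) * - (x - y + z) * (x + y - z) * - (x - y - z) = n"
    unfolding nonneg_solution_def quartic_eq_def quartic_factorization
    by (simp only: mult_minus_left mult_minus_right minus_minus)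
  with r show "C3 n x y z"
    unfolding C3_def of_int_eq_half_iff parameters_def
    by (intro exI[of _ "x + y + z"] exI[of _ "- (x - y + z)"] exI[of _ "x + y - z"]
          exI[of _ "- (x - y - z)"])
       (auto simp: nonneg_solution_def cong_iff_dvd_diff)
qed

lemma solution_sign_patterns:
  assumes "n > 0" and "nonneg_solution n x y z"
  shows "0 < x + y + z"
    and "(0 < x - y + z \<and> 0 < x + y - z \<and> 0 < x - y - z) \<or>
         (0 < x - y + z \<and> x + y - z < 0 \<and> x - y - z < 0) \<or>
         (x - y + z < 0 \<and> 0 < x + y - z \<and> x - y - z < 0)"
proof -
  have nonneg: "x \<ge> 0" "y \<ge> 0" "z \<ge> 0"
    and pos: "0 < (x + y + z) * (x - y + z) * (x + y - z) * (x - y - z)"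
    using assms unfolding nonneg_solution_def quartic_eq_def quartic_factorization by auto
  show "0 < x + y + z"
    using nonneg pos by (cases "x + y + z = 0") auto
  with pos nonneg show "(0 < x - y + z \<and> 0 < x + y - z \<and> 0 < x - y - z) \<or>
         (0 < x - y + z \<and> x + y - z < 0 \<and> x - y - z < 0) \<or>
         (x - y + z < 0 \<and> 0 < x + y - z \<and> x - y - z < 0)"
    unfolding zero_less_mult_iff mult_less_0_iff by linarith
qed

theorem theorem5:
  fixes n :: int
  assumes "n > 0"
  shows "(\<forall>x y z. nonneg_solution n x y z \<longrightarrow> C1 n x y z \<or> C2 n x y z \<or> C3 n x y z) \<and>
         (\<forall>x y z. C1 n x y z \<or> C2 n x y z \<or> C3 n x y z \<longrightarrow> nonneg_solution n x y z)"
  using solution_sign_patterns[OF assms] unfolding C1_iff C2_iff C3_iff by blast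

end
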